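(* Let $\Gamma\subset\mathbb R$ be an additive subgroup containing $\mathbb Z$, let $\alpha\in\Gamma$, $\alpha>0$, and let $$L_0=D^\alpha+\sum_{j=1}^{N}M_{p_j}D^{\beta_j}+V_{K_0}\quad\text{on }\mathcal M,\qquad p_j\in\mathbb C[t],\ \beta_j\in\Gamma,\ \beta_j<\alpha,\ K_0\in\mathcal K_{\mathrm{flat}}.$$ Put $X=C[0,T]$, $R_\alpha=J^\alpha:X\to X$ (which is injective), and let $A_\alpha=R_\alpha^{-1}$ with domain $\mathcal D(A_\alpha)=J^\alpha X$. Then: (i) $\mathcal M=J^\alpha\mathcal M\subset J^\alpha X$ and $A_\alpha|_{\mathcal M}=D^\alpha$. (ii) The operator $$W_0=\sum_{j=1}^{N}M_{p_j}J^{\alpha-\beta_j}+V_{K_0}J^\alpha$$ extends from $\mathcal M$ to a bounded Volterra operator $V_{G_0}$ on $X$, with $$G_0(t,s)=\sum_{j=1}^{N}p_j(t)h_{\alpha-\beta_j}(t-s)+\int_s^tK_0(t,\xi)h_\alpha(\xi-s)\,d\xi .$$ (iii) On $\mathcal M$ one has the right factorization $L_0=(I+W_0)D^\alpha$. Consequently $\widetilde L_0:=(I+V_{G_0})A_\alpha$, with domain $\mathcal D(\widetilde L_0)=J^\alpha X$, is an extension of $L_0$ in the sense that $\widetilde L_0|_{\mathcal M}=L_0$.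
   Context: Fix $T>0$; functions are complex-valued. Let $\mathcal M=\{f\in C^\infty[0,T]: f^{(n)}(0)=0\text{ for all }n\ge 0\}$. For $\mu>0$ put $(J^\mu f)(t)=\frac1{\Gamma(\mu)}\int_0^t(t-s)^{\mu-1}f(s)\,ds$ (with $\Gamma(\cdot)$ the gamma function) and $h_\mu(t)=t^{\mu-1}/\Gamma(\mu)$ for $t>0$. On $\mathcal M$ define $D^{-\mu}=J^\mu$ for $\mu>0$, $D^0=I$, and for $\alpha>0$, $D^\alpha f=J^{n-\alpha}f^{(n)}$ for any integer $n>\alpha$. $M_p$ is multiplication by $p$. With $\Delta_T=\{(t,s):0\le s\le t\le T\}$, for a bivariate kernel $K$ put $(V_Kf)(t)=\int_0^tK(t,s)f(s)\,ds$. $\mathcal K_{\mathrm{flat}}$ is the set of finite sums $K(t,s)=\sum_{r=1}^{N'}q_r(t)k_r(t-s)$ with $q_r\in\mathbb C[t]$, $k_r\in\mathcal M$. *)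

theory Defs
  imports "HOL-Analysis.Analysis" "HOL-Computational_Algebra.Polynomial"
begin

text \<open>
  A function on \<open>[0,T]\<close> is an element of \<open>extensional {0..T}\<close>, so that equality of HOL functions
  is equality on \<open>[0,T]\<close>. Every operator below returns such a function. Likewise, an operator
  with a domain is a HOL function restricted to that domain.
\<close>

definition C_space :: "real \<Rightarrow> (real \<Rightarrow> complex) set" where
  "C_space T = {f \<in> extensional {0..T}. continuous_on {0..T} f}"

definition sup_norm :: "real \<Rightarrow> (real \<Rightarrow> complex) \<Rightarrow> real" where
  "sup_norm T f = (SUP t\<in>{0..T}. norm (f t))"

text \<open>The derivative on \<open>[0,T]\<close>, one-sided at the end points.\<close>

definition deriv_on :: "real \<Rightarrow> (real \<Rightarrow> complex) \<Rightarrow> real \<Rightarrow> complex" where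
  "deriv_on T f = (\<lambda>t\<in>{0..T}. vector_derivative f (at t within {0..T}))"

definition flat_space :: "real \<Rightarrow> (real \<Rightarrow> complex) set" where
  "flat_space T = {f \<in> extensional {0..T}.
     \<forall>n. (deriv_on T ^^ n) f differentiable_on {0..T} \<and> (deriv_on T ^^ n) f 0 = 0}"

definition J :: "real \<Rightarrow> real \<Rightarrow> (real \<Rightarrow> complex) \<Rightarrow> real \<Rightarrow> complex" where
  "J T \<mu> f = (\<lambda>t\<in>{0..T}.
     complex_of_real (1 / Gamma \<mu>) *
     (LINT s:{0..t}|lborel. complex_of_real ((t - s) powr (\<mu> - 1)) * f s))"

definition h :: "real \<Rightarrow> real \<Rightarrow> complex" where
  "h \<mu> t = complex_of_real (t powr (\<mu> - 1) / Gamma \<mu>)"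

text \<open>
  For \<open>\<alpha> > 0\<close> we take the least integer \<open>n > \<alpha>\<close>; lemma \<open>D_eq\<close> below shows that every
  integer \<open>n > \<alpha>\<close> gives the same operator on \<open>flat_space T\<close>.
\<close>

definition D :: "real \<Rightarrow> real \<Rightarrow> (real \<Rightarrow> complex) \<Rightarrow> real \<Rightarrow> complex" where
  "D T \<alpha> f =
     (if \<alpha> < 0 then J T (- \<alpha>) f
      else if \<alpha> = 0 then f
      else (let n = (LEAST n::nat. \<alpha> < real n) in J T (real n - \<alpha>) ((deriv_on T ^^ n) f)))"

definition Mult :: "real \<Rightarrow> complex poly \<Rightarrow> (real \<Rightarrow> complex) \<Rightarrow> real \<Rightarrow> complex" where
  "Mult T p f = (\<lambda>t\<in>{0..T}. poly p (complex_of_real t) * f t)"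

definition V :: "real \<Rightarrow> (real \<Rightarrow> real \<Rightarrow> complex) \<Rightarrow> (real \<Rightarrow> complex) \<Rightarrow> real \<Rightarrow> complex" where
  "V T K f = (\<lambda>t\<in>{0..T}. LINT s:{0..t}|lborel. K t s * f s)"

text \<open>Kernels are only constrained on the triangle \<open>0 \<le> s \<le> t \<le> T\<close>, the only part \<open>V\<close> sees.\<close>

definition flat_kernels :: "real \<Rightarrow> (real \<Rightarrow> real \<Rightarrow> complex) set" where
  "flat_kernels T = {K. \<exists>(N::nat) q k. (\<forall>r\<in>{1..N}. k r \<in> flat_space T) \<and>
     (\<forall>t s. 0 \<le> s \<and> s \<le> t \<and> t \<le> T \<longrightarrow>
        K t s = (\<Sum>r=1..N. poly (q r) (complex_of_real t) * k r (t - s)))}"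

text \<open>
  The integral operator with kernel \<open>K\<close> is a well-defined bounded linear operator on \<open>C[0,T]\<close>
  with the supremum norm; in particular its defining integrals converge absolutely.
\<close>

definition bounded_Volterra :: "real \<Rightarrow> (real \<Rightarrow> real \<Rightarrow> complex) \<Rightarrow> bool" where
  "bounded_Volterra T K \<longleftrightarrow>
     (\<forall>f\<in>C_space T. \<forall>t\<in>{0..T}. set_integrable lborel {0..t} (\<lambda>s. K t s * f s)) \<and>
     V T K ` C_space T \<subseteq> C_space T \<and>
     (\<forall>f\<in>C_space T. \<forall>g\<in>C_space T. \<forall>a b.
        V T K (\<lambda>t\<in>{0..T}. a * f t + b * g t) = (\<lambda>t\<in>{0..T}. a * V T K f t + b * V T K g t)) \<and>
     (\<exists>C. \<forall>f\<in>C_space T. sup_norm T (V T K f) \<le> C * sup_norm T f)"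

definition L0 :: "real \<Rightarrow> real \<Rightarrow> nat \<Rightarrow> (nat \<Rightarrow> complex poly) \<Rightarrow> (nat \<Rightarrow> real) \<Rightarrow>
    (real \<Rightarrow> real \<Rightarrow> complex) \<Rightarrow> (real \<Rightarrow> complex) \<Rightarrow> real \<Rightarrow> complex" where
  "L0 T \<alpha> N p \<beta> K0 = (\<lambda>f\<in>flat_space T. \<lambda>t\<in>{0..T}.
     D T \<alpha> f t + (\<Sum>j=1..N. Mult T (p j) (D T (\<beta> j) f) t) + V T K0 f t)"

definition W0 :: "real \<Rightarrow> real \<Rightarrow> nat \<Rightarrow> (nat \<Rightarrow> complex poly) \<Rightarrow> (nat \<Rightarrow> real) \<Rightarrow>
    (real \<Rightarrow> real \<Rightarrow> complex) \<Rightarrow> (real \<Rightarrow> complex) \<Rightarrow> real \<Rightarrow> complex" where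
  "W0 T \<alpha> N p \<beta> K0 = (\<lambda>f\<in>flat_space T. \<lambda>t\<in>{0..T}.
     (\<Sum>j=1..N. Mult T (p j) (J T (\<alpha> - \<beta> j) f) t) + V T K0 (J T \<alpha> f) t)"

definition G0 :: "real \<Rightarrow> nat \<Rightarrow> (nat \<Rightarrow> complex poly) \<Rightarrow> (nat \<Rightarrow> real) \<Rightarrow>
    (real \<Rightarrow> real \<Rightarrow> complex) \<Rightarrow> real \<Rightarrow> real \<Rightarrow> complex" where
  "G0 \<alpha> N p \<beta> K0 t s =
     (\<Sum>j=1..N. poly (p j) (complex_of_real t) * h (\<alpha> - \<beta> j) (t - s)) +
     (LINT \<xi>:{s..t}|lborel. K0 t \<xi> * h \<alpha> (\<xi> - s))"

definition A_op :: "real \<Rightarrow> real \<Rightarrow> (real \<Rightarrow> complex) \<Rightarrow> real \<Rightarrow> complex" where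
  "A_op T \<alpha> = restrict (inv_into (C_space T) (J T \<alpha>)) (J T \<alpha> ` C_space T)"

definition L0_tilde :: "real \<Rightarrow> real \<Rightarrow> nat \<Rightarrow> (nat \<Rightarrow> complex poly) \<Rightarrow> (nat \<Rightarrow> real) \<Rightarrow>
    (real \<Rightarrow> real \<Rightarrow> complex) \<Rightarrow> (real \<Rightarrow> complex) \<Rightarrow> real \<Rightarrow> complex" where
  "L0_tilde T \<alpha> N p \<beta> K0 = (\<lambda>f\<in>J T \<alpha> ` C_space T. \<lambda>t\<in>{0..T}.
     A_op T \<alpha> f t + V T (G0 \<alpha> N p \<beta> K0) (A_op T \<alpha> f) t)"

lemma flat_space_deriv_on:
  assumes "f \<in> flat_space T"
  shows "deriv_on T f \<in> flat_space T"
proof -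
  have "(deriv_on T ^^ n) (deriv_on T f) = (deriv_on T ^^ Suc n) f" for n
    by (simp only: funpow_Suc_right comp_def)
  moreover have "deriv_on T f \<in> extensional {0..T}"
    by (simp add: deriv_on_def)
  moreover have "(deriv_on T ^^ Suc n) f differentiable_on {0..T} \<and> (deriv_on T ^^ Suc n) f 0 = 0" for n
    using assms unfolding flat_space_def by blast
  ultimately show ?thesis
    unfolding flat_space_def by (simp only: mem_Collect_eq) blast
qed

lemma flat_space_funpow_deriv_on:
  assumes "f \<in> flat_space T"
  shows "(deriv_on T ^^ n) f \<in> flat_space T"
  by (induction n) (use assms flat_space_deriv_on in auto)

lemma flat_space_continuous:
  assumes "f \<in> flat_space T"
  shows "continuous_on {0..T} f"
proof -
  have "(deriv_on T ^^ 0) f differentiable_on {0..T}"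
    using assms unfolding flat_space_def by blast
  then show ?thesis by (simp add: differentiable_imp_continuous_on)
qed

lemma flat_space_zero:
  assumes "f \<in> flat_space T"
  shows "f 0 = 0"
proof -
  have "(deriv_on T ^^ 0) f 0 = 0"
    using assms unfolding flat_space_def by blast
  then show ?thesis by simp
qed

lemma flat_space_has_vector_derivative:
  assumes "f \<in> flat_space T" "t \<in> {0<..<T}"
  shows "(f has_vector_derivative deriv_on T f t) (at t)"
proof -
  have "(deriv_on T ^^ 0) f differentiable_on {0..T}"
    using assms unfolding flat_space_def by blast
  then have "f differentiable (at t within {0..T})"
    using assms(2) by (auto simp: differentiable_on_def)
  then have "(f has_vector_derivative deriv_on T f t) (at t within {0..T})"
    using assms(2) by (simp add: deriv_on_def vector_derivative_works)
  moreover have "at t within {0..T} = at t"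
    using assms(2) at_within_Icc_at by auto
  ultimately show ?thesis by simp
qed

lemma set_integrable_powr_times:
  fixes f :: "real \<Rightarrow> complex"
  assumes "0 < \<mu>" "0 \<le> t" "continuous_on {0..t} f"
  shows "set_integrable lborel {0..t} (\<lambda>s. complex_of_real ((t - s) powr (\<mu> - 1)) * f s)"
proof -
  have "((\<lambda>x. x powr (\<mu> - 1)) has_integral (t powr (\<mu> - 1 + 1) / (\<mu> - 1 + 1))) {0..t}"
    by (rule has_integral_powr_from_0) (use assms in auto)
  then have "(\<lambda>x. x powr (\<mu> - 1)) integrable_on {0..t}"
    by blast
  then have "(\<lambda>s. (- s + t) powr (\<mu> - 1)) integrable_on {0..t}"
    using integrable_affinity[of "\<lambda>x. x powr (\<mu> - 1)" 0 t "-1" t]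
    by (simp add: image_affinity_atLeastAtMost)
  then have "(\<lambda>s. (t - s) powr (\<mu> - 1)) integrable_on {0..t}"
    by (simp add: algebra_simps)
  then have "(\<lambda>s. (t - s) powr (\<mu> - 1)) absolutely_integrable_on {0..t}"
    by (rule nonnegative_absolutely_integrable_1) auto
  then have 1: "set_integrable lborel {0..t} (\<lambda>s. (t - s) powr (\<mu> - 1))"
    unfolding set_integrable_def
    by (subst (asm) integrable_completion) auto
  have "compact (f ` {0..t})"
    using assms(3) by (intro compact_continuous_image) auto
  then have "bounded (f ` {0..t})" by (rule compact_imp_bounded)
  then obtain B where B: "\<And>s. s \<in> {0..t} \<Longrightarrow> norm (f s) \<le> B"
    unfolding bounded_iff by blast
  have fm: "set_borel_measurable lborel {0..t} f"
    using borel_measurable_continuous_on_indicator[OF _ assms(3)]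
    by (simp add: set_borel_measurable_def)
  have "set_integrable lborel {0..t} (\<lambda>s. B * (t - s) powr (\<mu> - 1))"
    using 1 by (rule set_integrable_mult_right)
  then show ?thesis
  proof (rule set_integrable_bound)
    have "(\<lambda>s. complex_of_real ((t - s) powr (\<mu> - 1)) * (indicator {0..t} s *\<^sub>R f s))
            \<in> borel_measurable lborel"
      using fm unfolding set_borel_measurable_def by measurable
    then show "set_borel_measurable lborel {0..t}
        (\<lambda>s. complex_of_real ((t - s) powr (\<mu> - 1)) * f s)"
      by (simp add: set_borel_measurable_def scaleR_conv_of_real mult_ac)
    show "AE s in lborel. s \<in> {0..t} \<longrightarrow>
        norm (complex_of_real ((t - s) powr (\<mu> - 1)) * f s) \<le> norm (B * (t - s) powr (\<mu> - 1))"
    proof (intro AE_I2 impI)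
      fix s assume s: "s \<in> {0..t}"
      have "norm (f s) \<le> \<bar>B\<bar>" using B[OF s] by linarith
      then show "norm (complex_of_real ((t - s) powr (\<mu> - 1)) * f s)
          \<le> norm (B * (t - s) powr (\<mu> - 1))"
        by (simp add: norm_mult abs_mult mult.commute mult_right_mono)
    qed
  qed
qed

lemma J_Suc_deriv_on:
  assumes "0 < \<mu>" "f \<in> flat_space T"
  shows "J T (\<mu> + 1) (deriv_on T f) = J T \<mu> f"
proof
  fix t
  show "J T (\<mu> + 1) (deriv_on T f) t = J T \<mu> f t"
  proof (cases "t \<in> {0..T}")
    case True
    then have sub: "{0..t} \<subseteq> {0..T}" and t: "0 \<le> t" "t \<le> T" by auto
    let ?P = "\<lambda>s. complex_of_real ((t - s) powr \<mu>)"
    let ?p = "\<lambda>s. complex_of_real ((t - s) powr (\<mu> - 1))"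
    let ?I = "LINT s:{0..t}|lborel. ?P s * deriv_on T f s"
    have cf: "continuous_on {0..t} f" and cf': "continuous_on {0..t} (deriv_on T f)"
      using continuous_on_subset[OF flat_space_continuous sub] assms(2) flat_space_deriv_on by blast+
    have i1: "set_integrable lborel {0..t} (\<lambda>s. ?P s * deriv_on T f s)"
      using set_integrable_powr_times[of "\<mu> + 1", OF _ t(1) cf'] assms(1) by simp
    have i2: "set_integrable lborel {0..t} (\<lambda>s. ?p s * f s)"
      using set_integrable_powr_times[OF assms(1) t(1) cf] .
    have I1: "((\<lambda>s. ?P s * deriv_on T f s) has_integral ?I) {0..t}"
      using set_borel_integral_eq_integral[OF i1] by (simp add: has_integral_integrable_integral)
    have dP: "(?P has_vector_derivative - complex_of_real \<mu> * ?p s) (at s)" if "s \<in> {0<..<t}" for s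
    proof -
      have "((\<lambda>s. (t - s) powr \<mu>) has_real_derivative - \<mu> * (t - s) powr (\<mu> - 1)) (at s)"
        using that by (auto intro!: derivative_eq_intros)
      from has_vector_derivative_of_real[OF this] show ?thesis by simp
    qed
    have "((\<lambda>s. (- complex_of_real \<mu> * ?p s) * f s) has_integral - ?I) {0..t}"
    proof (rule integration_by_parts_interior[where prod = "(*)" and f = ?P and g = f
          and g' = "deriv_on T f"])
      show "bounded_bilinear ((*) :: complex \<Rightarrow> complex \<Rightarrow> complex)"
        by (rule bounded_bilinear_mult)
      show "continuous_on {0..t} ?P"
        by (intro continuous_on_of_real continuous_on_powr' continuous_on_diff
              continuous_on_const continuous_on_id) (use assms(1) in auto)
      show "(f has_vector_derivative deriv_on T f s) (at s)" if "s \<in> {0<..<t}" for s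
        using flat_space_has_vector_derivative[OF assms(2)] that t by auto
      show "((\<lambda>s. ?P s * deriv_on T f s) has_integral
          ?P t * f t - ?P 0 * f 0 - (- ?I)) {0..t}"
        using I1 assms(1) flat_space_zero[OF assms(2)] by simp
    qed (use t cf dP in auto)
    moreover have "((\<lambda>s. - complex_of_real \<mu> * (?p s * f s)) has_integral
        - complex_of_real \<mu> * (LINT s:{0..t}|lborel. ?p s * f s)) {0..t}"
      using set_borel_integral_eq_integral[OF i2]
      by (intro has_integral_mult_right) (simp add: has_integral_integrable_integral)
    ultimately have "- ?I = - complex_of_real \<mu> * (LINT s:{0..t}|lborel. ?p s * f s)"
      unfolding mult.assoc by (rule has_integral_unique)
    then have "?I = complex_of_real \<mu> * (LINT s:{0..t}|lborel. ?p s * f s)"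
      by simp
    moreover have "Gamma (\<mu> + 1) = \<mu> * Gamma \<mu>"
      using assms(1) by (intro Gamma_plus1) (auto elim!: nonpos_Ints_cases)
    ultimately show ?thesis
      using True assms(1) by (simp add: J_def)
  qed (auto simp: J_def)
qed

lemma D_eq:
  assumes "f \<in> flat_space T" "0 < \<alpha>" "\<alpha> < real n"
  shows "D T \<alpha> f = J T (real n - \<alpha>) ((deriv_on T ^^ n) f)"
proof -
  define m where "m = (LEAST n::nat. \<alpha> < real n)"
  have m: "\<alpha> < real m" "m \<le> n"
    using assms(3) unfolding m_def by (auto intro: LeastI Least_le)
  from m(2) have "J T (real n - \<alpha>) ((deriv_on T ^^ n) f) = J T (real m - \<alpha>) ((deriv_on T ^^ m) f)"
  proof (induction n rule: dec_induct)
    case (step k)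
    then have "0 < real k - \<alpha>" using m(1) by linarith
    from J_Suc_deriv_on[OF this flat_space_funpow_deriv_on[OF assms(1)]] step
    show ?case by (simp add: algebra_simps)
  qed simp
  then show ?thesis using assms(2) by (simp add: D_def m_def Let_def)
qed

end

theory Submission
  imports Defs
begin

text \<open>
  Everything reduces to three properties of the Riemann--Liouville integrals \<open>J\<^sup>\<mu>\<close>, \<open>\<mu> > 0\<close>.

  They form a semigroup on \<open>C[0,T]\<close> (\<open>J_J\<close>): by Fubini on the triangle
  (\<open>set_integral_triangle_swap\<close>), a composition of two Volterra operators of convolution type has
  the convolution of the kernels as its kernel, and the Beta integral says that the kernels \<open>h \<mu>\<close>
  satisfy \<open>h \<nu> * h \<mu> = h (\<nu> + \<mu>)\<close> (\<open>h_convolution\<close>). Injectivity of \<open>J\<^sup>\<alpha>\<close> follows, as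
  \<open>J\<^sup>\<alpha>\<close> can be completed to an iterated ordinary primitive \<open>J\<^sup>n\<close>, which differentiation inverts.

  They are bounded on \<open>C[0,T]\<close>: the substitution \<open>s = t u\<close> moves the integral to the fixed interval
  \<open>[0,1]\<close> with a fixed integrable weight, so that dominated convergence gives continuity of the
  image and the \<open>L\<^sup>1\<close> norm of the weight a bound (\<open>bounded_on_C_rescaled_integral\<close>). The same
  argument covers convolution with a continuous function, hence \<open>V\<close> with a flat kernel.

  They commute with differentiation on the flat functions, because the boundary terms at \<open>0\<close>
  vanish. So \<open>J\<^sup>\<mu>\<close> preserves flat functions, \<open>J\<^sup>\<alpha> D\<^sup>\<alpha> = I\<close> there, and more generally
  \<open>J\<^bsup>\<alpha>-\<beta>\<^esup> D\<^sup>\<alpha> = D\<^sup>\<beta>\<close> for every real \<open>\<beta> < \<alpha>\<close> (\<open>J_D_eq_D\<close>).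

  The last identity, applied to each term of \<open>L0\<close>, is the right factorization
  \<open>L0 = (I + W0) D\<^sup>\<alpha>\<close>. A second use of Fubini on the triangle, now for \<open>V K0\<close> after \<open>J\<^sup>\<alpha>\<close>,
  identifies \<open>W0\<close> with the Volterra operator of the kernel \<open>G0\<close> (\<open>V_G0_eq\<close>), and this identity
  makes sense, with bounded operators, on all of \<open>C[0,T]\<close>. As \<open>A_op\<close> agrees with
  \<open>D\<^sup>\<alpha>\<close> on flat functions (\<open>A_op_eq_D\<close>), \<open>L0_tilde\<close> extends \<open>L0\<close>.
\<close>

section \<open>Convolution kernels on the triangle\<close>

text \<open>
  By translation invariance the integral of \<open>norm (\<phi> \<xi> * \<psi> (\<xi> - s))\<close> over \<open>s\<close> is
  \<open>norm (\<phi> \<xi>)\<close> times the \<open>L\<^sup>1\<close> norm of \<open>\<psi>\<close>, so Tonelli applies.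
\<close>
lemma integrable_convolution_integrand:
  fixes \<phi> \<psi> :: "real \<Rightarrow> complex"
  assumes "integrable lborel \<phi>" "integrable lborel \<psi>"
  shows "integrable (lborel \<Otimes>\<^sub>M lborel) (\<lambda>(\<xi>, s). \<phi> \<xi> * \<psi> (\<xi> - s))"
proof (rule lborel_pair.Fubini_integrable)
  have [measurable]: "\<phi> \<in> borel_measurable borel" "\<psi> \<in> borel_measurable borel"
    using assms by auto
  show "(\<lambda>(\<xi>, s). \<phi> \<xi> * \<psi> (\<xi> - s)) \<in> borel_measurable (lborel \<Otimes>\<^sub>M lborel)"
    by measurable
  have translate: "integrable lborel (\<lambda>s. \<psi> (\<xi> - s))" for \<xi>
    using lborel_integrable_real_affine[OF assms(2), of "-1" \<xi>] by simp
  then show "AE \<xi> in lborel. integrable lborel (\<lambda>s. case (\<xi>, s) of (\<xi>, s) \<Rightarrow> \<phi> \<xi> * \<psi> (\<xi> - s))"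
    by simp
  have "(LINT s|lborel. norm (\<psi> (\<xi> - s))) = (LINT s|lborel. norm (\<psi> s))" for \<xi>
    using lborel_integral_real_affine[of "-1" "\<lambda>s. norm (\<psi> s)" \<xi>] by simp
  then show "integrable lborel
      (\<lambda>\<xi>. LINT s|lborel. norm (case (\<xi>, s) of (\<xi>, s) \<Rightarrow> \<phi> \<xi> * \<psi> (\<xi> - s)))"
    using assms(1) by (simp add: norm_mult)
qed

text \<open>
  Composition of \<open>V\<close> with a kernel row \<open>\<phi>\<close> after a convolution with \<open>\<psi>\<close>. Extend \<open>\<phi>\<close>, \<open>\<psi>\<close> and
  \<open>f\<close> by zero outside \<open>[0,t]\<close>: then \<open>\<phi> \<xi> * \<psi> (\<xi> - s) * f s\<close> vanishes off the triangle
  \<open>0 \<le> s \<le> \<xi> \<le> t\<close> by itself, and swapping the integrals over the whole plane produces the correct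
  limits on both sides.
\<close>
lemma
  fixes \<phi> \<psi> f :: "real \<Rightarrow> complex"
  assumes \<phi>: "set_integrable lborel {0..t} \<phi>" and \<psi>: "set_integrable lborel {0..t} \<psi>"
    and f: "continuous_on {0..t} f"
  shows set_integrable_composed_kernel:
      "set_integrable lborel {0..t} (\<lambda>s. (LINT \<xi>:{s..t}|lborel. \<phi> \<xi> * \<psi> (\<xi> - s)) * f s)"
    and set_integral_triangle_swap:
      "(LINT \<xi>:{0..t}|lborel. \<phi> \<xi> * (LINT s:{0..\<xi>}|lborel. \<psi> (\<xi> - s) * f s)) =
       (LINT s:{0..t}|lborel. (LINT \<xi>:{s..t}|lborel. \<phi> \<xi> * \<psi> (\<xi> - s)) * f s)"
proof -
  define \<phi>0 where "\<phi>0 = (\<lambda>x. indicator {0..t} x *\<^sub>R \<phi> x)"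
  define \<psi>0 where "\<psi>0 = (\<lambda>x. indicator {0..t} x *\<^sub>R \<psi> x)"
  define f0 where "f0 = (\<lambda>x. indicator {0..t} x *\<^sub>R f x)"
  have [measurable]: "f0 \<in> borel_measurable borel"
    unfolding f0_def by (rule borel_measurable_continuous_on_indicator[OF _ f]) simp
  have "bounded (f ` {0..t})"
    using f by (intro compact_imp_bounded compact_continuous_image) auto
  then obtain B where B: "0 < B" "\<And>s. s \<in> {0..t} \<Longrightarrow> norm (f s) \<le> B"
    unfolding bounded_pos by auto
  then have f0_bound: "norm (f0 s) \<le> B" for s
    by (auto simp: f0_def indicator_def)
  have "integrable (lborel \<Otimes>\<^sub>M lborel) (\<lambda>(\<xi>, s). \<phi>0 \<xi> * \<psi>0 (\<xi> - s))"
    using \<phi> \<psi> unfolding set_integrable_def \<phi>0_def \<psi>0_def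
    by (rule integrable_convolution_integrand)
  then have conv: "integrable (lborel \<Otimes>\<^sub>M lborel) (\<lambda>p. B *\<^sub>R (case p of (\<xi>, s) \<Rightarrow> \<phi>0 \<xi> * \<psi>0 (\<xi> - s)))"
    by (rule integrable_scaleR_right)
  have [measurable]: "\<phi>0 \<in> borel_measurable borel" "\<psi>0 \<in> borel_measurable borel"
    using \<phi> \<psi> unfolding set_integrable_def \<phi>0_def \<psi>0_def by auto
  have int: "integrable (lborel \<Otimes>\<^sub>M lborel) (\<lambda>(\<xi>, s). \<phi>0 \<xi> * \<psi>0 (\<xi> - s) * f0 s)"
  proof (rule Bochner_Integration.integrable_bound[OF conv])
    show "AE p in lborel \<Otimes>\<^sub>M lborel. norm (case p of (\<xi>, s) \<Rightarrow> \<phi>0 \<xi> * \<psi>0 (\<xi> - s) * f0 s)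
        \<le> norm (B *\<^sub>R (case p of (\<xi>, s) \<Rightarrow> \<phi>0 \<xi> * \<psi>0 (\<xi> - s)))"
    proof (intro AE_I2, clarify)
      fix \<xi> s
      show "norm (\<phi>0 \<xi> * \<psi>0 (\<xi> - s) * f0 s) \<le> norm (B *\<^sub>R (\<phi>0 \<xi> * \<psi>0 (\<xi> - s)))"
        using mult_left_mono[OF f0_bound[of s], of "norm (\<phi>0 \<xi> * \<psi>0 (\<xi> - s))"] B(1)
        by (simp add: norm_mult mult_ac)
    qed
  qed measurable
  \<comment> \<open>The supports of the three factors cut out the triangle, here read row by row and column by column.\<close>
  have fst: "(LINT s|lborel. \<phi>0 \<xi> * \<psi>0 (\<xi> - s) * f0 s) =
      indicator {0..t} \<xi> *\<^sub>R (\<phi> \<xi> * (LINT s:{0..\<xi>}|lborel. \<psi> (\<xi> - s) * f s))" for \<xi>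
  proof -
    have "(LINT s|lborel. \<phi>0 \<xi> * \<psi>0 (\<xi> - s) * f0 s) =
        (LINT s|lborel. (indicator {0..t} \<xi> *\<^sub>R \<phi> \<xi>) * (indicator {0..\<xi>} s *\<^sub>R (\<psi> (\<xi> - s) * f s)))"
      by (rule Bochner_Integration.integral_cong)
         (auto simp: \<phi>0_def \<psi>0_def f0_def indicator_def)
    then show ?thesis
      unfolding integral_mult_right_zero by (simp add: set_lebesgue_integral_def)
  qed
  have snd: "(LINT \<xi>|lborel. \<phi>0 \<xi> * \<psi>0 (\<xi> - s) * f0 s) =
      indicator {0..t} s *\<^sub>R ((LINT \<xi>:{s..t}|lborel. \<phi> \<xi> * \<psi> (\<xi> - s)) * f s)" for s
  proof -
    have "(LINT \<xi>|lborel. \<phi>0 \<xi> * \<psi>0 (\<xi> - s) * f0 s) =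
        (LINT \<xi>|lborel. (indicator {s..t} \<xi> *\<^sub>R (\<phi> \<xi> * \<psi> (\<xi> - s))) * (indicator {0..t} s *\<^sub>R f s))"
      by (rule Bochner_Integration.integral_cong)
         (auto simp: \<phi>0_def \<psi>0_def f0_def indicator_def)
    then show ?thesis
      unfolding integral_mult_left_zero by (simp add: set_lebesgue_integral_def)
  qed
  show "set_integrable lborel {0..t} (\<lambda>s. (LINT \<xi>:{s..t}|lborel. \<phi> \<xi> * \<psi> (\<xi> - s)) * f s)"
    using lborel_pair.integrable_snd[OF int] unfolding snd set_integrable_def .
  show "(LINT \<xi>:{0..t}|lborel. \<phi> \<xi> * (LINT s:{0..\<xi>}|lborel. \<psi> (\<xi> - s) * f s)) =
       (LINT s:{0..t}|lborel. (LINT \<xi>:{s..t}|lborel. \<phi> \<xi> * \<psi> (\<xi> - s)) * f s)"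
    using lborel_pair.Fubini_integral[OF int] unfolding fst snd set_lebesgue_integral_def by simp
qed

lemma set_integral_rescale_unit:
  fixes F :: "real \<Rightarrow> complex"
  assumes "0 \<le> t"
  shows "(LINT s:{a..a + t}|lborel. F s) = complex_of_real t * (LINT u:{0..1}|lborel. F (a + t * u))"
proof (cases "t = 0")
  case True
  have "(LINT s:{a..a}|lborel. F s) = (LINT s|lborel. indicator {a} s *\<^sub>R F a)"
    unfolding set_lebesgue_integral_def
    by (rule Bochner_Integration.integral_cong) (auto simp: indicator_def)
  then show ?thesis
    using True by simp
next
  case False
  then have "0 < t" using assms by simp
  then have "indicator {a..a + t} (a + t * u) = (indicator {0..1} u :: real)" for u
    by (auto simp: indicator_def zero_le_mult_iff)
  then show ?thesis
    using lborel_integral_real_affine[OF False, of "\<lambda>s. indicator {a..a + t} s *\<^sub>R F s" a] assms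
    by (simp add: set_lebesgue_integral_def scaleR_conv_of_real)
qed

text \<open>Both orientations occur: the left factor of a composition has the reflected kernel.\<close>
lemma set_integrable_h:
  assumes "0 < \<mu>" "0 \<le> t"
  shows "set_integrable lborel {0..t} (h \<mu>)" "set_integrable lborel {0..t} (\<lambda>s. h \<mu> (t - s))"
proof -
  have "set_integrable lborel {0..t}
      (\<lambda>s. complex_of_real ((t - s) powr (\<mu> - 1)) * complex_of_real (1 / Gamma \<mu>))"
    by (rule set_integrable_powr_times[OF assms]) (rule continuous_on_const)
  then show r: "set_integrable lborel {0..t} (\<lambda>s. h \<mu> (t - s))"
    by (simp add: h_def)
  show "set_integrable lborel {0..t} (h \<mu>)"
  proof -
    have "indicator {0..t} (t - s) = (indicator {0..t} s :: real)" for s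
      by (auto simp: indicator_def)
    then show ?thesis
      using lborel_integrable_real_affine_iff[of "-1" "\<lambda>s. indicator {0..t} s *\<^sub>R h \<mu> (t - s)" t] r
      by (simp add: set_integrable_def)
  qed
qed

text \<open>
  The semigroup law at the level of kernels. With \<open>\<xi> = s + (t - s) u\<close> the integral becomes a power
  of \<open>t - s\<close> times \<open>Beta \<mu> \<nu>\<close>, whose Gamma factors cancel those of \<open>h\<close>. The case \<open>s = t\<close> is
  included because \<open>0 powr a = 0\<close> for every exponent, so that \<open>h\<close> vanishes at \<open>0\<close>.
\<close>
lemma h_convolution:
  assumes "0 < \<mu>" "0 < \<nu>" "s \<le> t"
  shows "(LINT \<xi>:{s..t}|lborel. h \<nu> (t - \<xi>) * h \<mu> (\<xi> - s)) = h (\<nu> + \<mu>) (t - s)"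
proof -
  let ?\<tau> = "t - s"
  have "(LINT u:{0..1}|lborel. u powr (\<mu> - 1) * (1 - u) powr (\<nu> - 1)) = Beta \<mu> \<nu>"
  proof -
    have Beta: "((\<lambda>u. u powr (\<mu> - 1) * (1 - u) powr (\<nu> - 1)) has_integral Beta \<mu> \<nu>) {0..1}"
      using has_integral_Beta_real[OF assms(1,2)] .
    then have "(\<lambda>u. u powr (\<mu> - 1) * (1 - u) powr (\<nu> - 1)) absolutely_integrable_on {0..1}"
      by (intro nonnegative_absolutely_integrable_1) (auto simp: integrable_on_def)
    then have "set_integrable lborel {0..1} (\<lambda>u. u powr (\<mu> - 1) * (1 - u) powr (\<nu> - 1))"
      unfolding set_integrable_def by (subst (asm) integrable_completion) auto
    from set_borel_integral_eq_integral(2)[OF this] Beta show ?thesis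
      by (simp add: integral_unique)
  qed
  moreover have "(LINT u:{0..1}|lborel. complex_of_real (u powr (\<mu> - 1) * (1 - u) powr (\<nu> - 1))) =
      complex_of_real (LINT u:{0..1}|lborel. u powr (\<mu> - 1) * (1 - u) powr (\<nu> - 1))"
    by (rule set_integral_complex_of_real)
  ultimately have Beta: "(LINT u:{0..1}|lborel. complex_of_real (u powr (\<mu> - 1) * (1 - u) powr (\<nu> - 1)))
      = complex_of_real (Beta \<mu> \<nu>)"
    by simp
  have \<tau>: "?\<tau> * (?\<tau> powr (\<nu> - 1) * ?\<tau> powr (\<mu> - 1)) = ?\<tau> powr (\<nu> + \<mu> - 1)"
    using assms(3) powr_mult_base[of ?\<tau> "\<nu> - 1 + (\<mu> - 1)"]
    by (simp flip: powr_add)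
  have "(LINT \<xi>:{s..t}|lborel. h \<nu> (t - \<xi>) * h \<mu> (\<xi> - s)) =
      ?\<tau> * (LINT u:{0..1}|lborel. h \<nu> (t - (s + ?\<tau> * u)) * h \<mu> (?\<tau> * u))"
    using set_integral_rescale_unit[of ?\<tau> s "\<lambda>\<xi>. h \<nu> (t - \<xi>) * h \<mu> (\<xi> - s)"] assms(3) by simp
  also have "(LINT u:{0..1}|lborel. h \<nu> (t - (s + ?\<tau> * u)) * h \<mu> (?\<tau> * u)) =
      (LINT u:{0..1}|lborel. complex_of_real (?\<tau> powr (\<nu> - 1) * ?\<tau> powr (\<mu> - 1) / (Gamma \<nu> * Gamma \<mu>)) *
         complex_of_real (u powr (\<mu> - 1) * (1 - u) powr (\<nu> - 1)))"
  proof (rule set_lebesgue_integral_cong, simp, intro allI impI)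
    fix u :: real assume u: "u \<in> {0..1}"
    have "t - (s + ?\<tau> * u) = ?\<tau> * (1 - u)" by (simp add: algebra_simps)
    then show "h \<nu> (t - (s + ?\<tau> * u)) * h \<mu> (?\<tau> * u) =
        complex_of_real (?\<tau> powr (\<nu> - 1) * ?\<tau> powr (\<mu> - 1) / (Gamma \<nu> * Gamma \<mu>)) *
         complex_of_real (u powr (\<mu> - 1) * (1 - u) powr (\<nu> - 1))"
      using u assms(3) by (simp add: h_def powr_mult flip: of_real_mult)
  qed
  also have "?\<tau> * \<dots> = complex_of_real
      (?\<tau> * (?\<tau> powr (\<nu> - 1) * ?\<tau> powr (\<mu> - 1)) * Beta \<mu> \<nu> / (Gamma \<nu> * Gamma \<mu>))"
    unfolding set_integral_mult_right Beta by (simp add: mult_ac)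
  also have "\<dots> = h (\<nu> + \<mu>) ?\<tau>"
    unfolding \<tau> h_def using Gamma_real_pos[OF assms(1)] Gamma_real_pos[OF assms(2)]
    by (simp add: Beta_def add.commute)
  finally show ?thesis .
qed

section \<open>Integrals over the unit interval with a parameter\<close>

text \<open>Dominated convergence: \<open>H\<close> is bounded on its compact domain, so a multiple of \<open>w\<close> dominates.\<close>
lemma continuous_on_weighted_integral:
  fixes w :: "real \<Rightarrow> complex" and H :: "real \<Rightarrow> real \<Rightarrow> complex"
  assumes w: "set_integrable lborel {0..1} w"
    and H: "continuous_on ({0..T} \<times> {0..1}) (\<lambda>(t, u). H t u)"
  shows "continuous_on {0..T} (\<lambda>t. LINT u:{0..1}|lborel. w u * H t u)"
  unfolding continuous_on_sequentially
proof (intro allI ballI impI, elim conjE)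
  fix a and x :: "nat \<Rightarrow> real"
  assume a: "a \<in> {0..T}" and x: "\<forall>n. x n \<in> {0..T}" "x \<longlonglongrightarrow> a"
  have "bounded ((\<lambda>(t, u). H t u) ` ({0..T} \<times> {0..1}))"
    using H by (intro compact_imp_bounded compact_continuous_image compact_Times) auto
  then obtain B where B: "\<And>t u. t \<in> {0..T} \<Longrightarrow> u \<in> {0..1} \<Longrightarrow> norm (H t u) \<le> B"
    unfolding bounded_iff by fastforce
  have wm [measurable]: "(\<lambda>u. indicator {0..1} u *\<^sub>R w u) \<in> borel_measurable lborel"
    using w by (auto simp: set_integrable_def)
  have meas: "(\<lambda>u. indicator {0..1} u *\<^sub>R (w u * H t u)) \<in> borel_measurable lborel"
    if "t \<in> {0..T}" for t
  proof -
    have "continuous_on {0..1} (\<lambda>u. (\<lambda>(t, u). H t u) (t, u))"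
      by (rule continuous_on_compose2[OF H]) (use that in \<open>auto intro!: continuous_intros\<close>)
    then have [measurable]: "(\<lambda>u. indicator {0..1} u *\<^sub>R H t u) \<in> borel_measurable lborel"
      using borel_measurable_continuous_on_indicator[of "{0..1}" "H t"] by simp
    have "(\<lambda>u. (indicator {0..1} u *\<^sub>R w u) * (indicator {0..1} u *\<^sub>R H t u)) \<in> borel_measurable lborel"
      by measurable
    then show ?thesis
      by (rule measurable_cong[THEN iffD1, rotated]) (auto simp: indicator_def)
  qed
  have "(\<lambda>n. LINT u|lborel. indicator {0..1} u *\<^sub>R (w u * H (x n) u)) \<longlonglongrightarrow>
      (LINT u|lborel. indicator {0..1} u *\<^sub>R (w u * H a u))"
  proof (rule integral_dominated_convergence)
    show "integrable lborel (\<lambda>u. \<bar>B\<bar> * norm (indicator {0..1} u *\<^sub>R w u))"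
      using w unfolding set_integrable_def by (intro integrable_mult_right integrable_norm)
    show "AE u in lborel. (\<lambda>n. indicator {0..1} u *\<^sub>R (w u * H (x n) u)) \<longlonglongrightarrow>
        indicator {0..1} u *\<^sub>R (w u * H a u)"
    proof (intro AE_I2)
      fix u :: real
      show "(\<lambda>n. indicator {0..1} u *\<^sub>R (w u * H (x n) u)) \<longlonglongrightarrow> indicator {0..1} u *\<^sub>R (w u * H a u)"
      proof (cases "u \<in> {0..1}")
        case True
        have "continuous_on {0..T} (\<lambda>t. (\<lambda>(t, u). H t u) (t, u))"
          by (rule continuous_on_compose2[OF H]) (use True in \<open>auto intro!: continuous_intros\<close>)
        then have "(\<lambda>n. H (x n) u) \<longlonglongrightarrow> H a u"
          using a x unfolding continuous_on_sequentially by (auto simp: comp_def)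
        then show ?thesis by (intro tendsto_intros)
      qed simp
    qed
    show "AE u in lborel. norm (indicator {0..1} u *\<^sub>R (w u * H (x n) u))
        \<le> \<bar>B\<bar> * norm (indicator {0..1} u *\<^sub>R w u)" for n
    proof (intro AE_I2)
      fix u :: real
      have "norm (H (x n) u) \<le> \<bar>B\<bar>" if "u \<in> {0..1}"
        using B[OF x(1)[rule_format] that, of n] by linarith
      then show "norm (indicator {0..1} u *\<^sub>R (w u * H (x n) u))
          \<le> \<bar>B\<bar> * norm (indicator {0..1} u *\<^sub>R w u)"
        by (auto simp: indicator_def norm_mult mult.commute[of "\<bar>B\<bar>"] mult_left_mono)
    qed
  qed (use a x meas in auto)
  then show "((\<lambda>t. LINT u:{0..1}|lborel. w u * H t u) \<circ> x) \<longlonglongrightarrow> (LINT u:{0..1}|lborel. w u * H a u)"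
    by (simp add: set_lebesgue_integral_def comp_def)
qed

lemma norm_weighted_integral_le:
  fixes w g :: "real \<Rightarrow> complex"
  assumes w: "set_integrable lborel {0..1} w" and g: "\<And>u. u \<in> {0..1} \<Longrightarrow> norm (g u) \<le> B"
  shows "norm (LINT u:{0..1}|lborel. w u * g u) \<le> B * (LINT u:{0..1}|lborel. norm (w u))"
proof -
  have "0 \<le> B" using order_trans[OF norm_ge_zero g[of 0]] by simp
  have "norm (LINT u:{0..1}|lborel. w u * g u) \<le>
      (LINT u|lborel. norm (indicator {0..1} u *\<^sub>R (w u * g u)))"
    unfolding set_lebesgue_integral_def by (rule integral_norm_bound)
  also have "\<dots> \<le> (LINT u|lborel. B * norm (indicator {0..1} u *\<^sub>R w u))"
  proof (rule integral_mono')
    show "integrable lborel (\<lambda>u. B * norm (indicator {0..1} u *\<^sub>R w u))"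
      using w unfolding set_integrable_def by (intro integrable_mult_right integrable_norm)
  qed (use g \<open>0 \<le> B\<close> in \<open>auto simp: indicator_def norm_mult mult.commute[of B] mult_left_mono\<close>)
  also have "\<dots> = B * (LINT u:{0..1}|lborel. norm (w u))"
    by (simp add: set_lebesgue_integral_def abs_mult)
  finally show ?thesis .
qed

section \<open>The semigroup of fractional integrals\<close>

lemma C_space_continuous_on_subset:
  assumes "f \<in> C_space T" "t \<le> T"
  shows "continuous_on {0..t} f"
  using assms by (auto simp: C_space_def intro: continuous_on_subset)

lemma restrict_in_C_space:
  assumes "continuous_on {0..T} f"
  shows "restrict f {0..T} \<in> C_space T"
  unfolding C_space_def using assms by (auto intro: continuous_on_eq)

lemma flat_space_subset_C_space: "flat_space T \<subseteq> C_space T"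
  using flat_space_continuous by (auto simp: C_space_def flat_space_def)

text \<open>
  \<open>J\<^sup>\<mu>\<close> as convolution with \<open>h \<mu>\<close>: this is the form to which Fubini and the Beta integral apply.
\<close>
lemma J_eq_h_convolution:
  assumes "t \<in> {0..T}"
  shows "J T \<mu> f t = (LINT s:{0..t}|lborel. h \<mu> (t - s) * f s)"
proof -
  have "(LINT s:{0..t}|lborel. h \<mu> (t - s) * f s) =
      (LINT s:{0..t}|lborel. complex_of_real (1 / Gamma \<mu>) *
        (complex_of_real ((t - s) powr (\<mu> - 1)) * f s))"
    by (simp add: h_def)
  then show ?thesis
    using assms by (simp only: set_integral_mult_right J_def restrict_apply if_True)
qed

lemma set_integrable_h_times:
  assumes "0 < \<mu>" "0 \<le> t" "continuous_on {0..t} f"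
  shows "set_integrable lborel {0..t} (\<lambda>s. h \<mu> (t - s) * f s)"
  using set_integrable_mult_right[OF set_integrable_powr_times[OF assms], of "complex_of_real (1 / Gamma \<mu>)"]
  by (simp add: h_def)

lemma J_J:
  assumes "0 < \<mu>" "0 < \<nu>" "f \<in> C_space T"
  shows "J T \<nu> (J T \<mu> f) = J T (\<nu> + \<mu>) f"
proof
  fix t
  show "J T \<nu> (J T \<mu> f) t = J T (\<nu> + \<mu>) f t"
  proof (cases "t \<in> {0..T}")
    case True
    then have f: "continuous_on {0..t} f" and "0 \<le> t"
      using C_space_continuous_on_subset[OF assms(3)] by auto
    have "J T \<nu> (J T \<mu> f) t = (LINT \<xi>:{0..t}|lborel. h \<nu> (t - \<xi>) * J T \<mu> f \<xi>)"
      by (rule J_eq_h_convolution[OF True])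
    also have "\<dots> = (LINT \<xi>:{0..t}|lborel. h \<nu> (t - \<xi>) * (LINT s:{0..\<xi>}|lborel. h \<mu> (\<xi> - s) * f s))"
      by (intro set_lebesgue_integral_cong) (use True in \<open>auto simp: J_eq_h_convolution\<close>)
    also have "\<dots> = (LINT s:{0..t}|lborel. (LINT \<xi>:{s..t}|lborel. h \<nu> (t - \<xi>) * h \<mu> (\<xi> - s)) * f s)"
      using assms(1,2) \<open>0 \<le> t\<close> f by (intro set_integral_triangle_swap set_integrable_h)
    also have "\<dots> = (LINT s:{0..t}|lborel. h (\<nu> + \<mu>) (t - s) * f s)"
      by (intro set_lebesgue_integral_cong) (use assms in \<open>auto simp: h_convolution\<close>)
    finally show ?thesis
      by (simp add: J_eq_h_convolution[OF True])
  qed (auto simp: J_def)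
qed

section \<open>Bounded operators on the continuous functions\<close>

text \<open>
  Boundedness is stated with an arbitrary pointwise bound \<open>B\<close> in place of the supremum norm, which
  makes it compose without any discussion of suprema; \<open>bounded_on_C_sup_norm\<close> translates it back.
\<close>
definition bounded_on_C :: "real \<Rightarrow> ((real \<Rightarrow> complex) \<Rightarrow> real \<Rightarrow> complex) \<Rightarrow> bool" where
  "bounded_on_C T F \<longleftrightarrow> F ` C_space T \<subseteq> C_space T \<and>
     (\<exists>c\<ge>0. \<forall>f\<in>C_space T. \<forall>B. (\<forall>t\<in>{0..T}. norm (f t) \<le> B) \<longrightarrow> (\<forall>t\<in>{0..T}. norm (F f t) \<le> c * B))"

text \<open>
  The common shape of \<open>J\<^sup>\<mu>\<close> and of convolution with a continuous function after the substitution
  \<open>s = t u\<close>. For \<open>J\<^sup>\<mu>\<close> the singularity goes into the weight \<open>w\<close> and \<open>k\<close> is constant; for a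
  convolution \<open>w\<close> is constant and \<open>k\<close> is the convolution kernel.
\<close>
lemma bounded_on_C_rescaled_integral:
  assumes w: "set_integrable lborel {0..1} w"
    and m: "continuous_on {0..T} m"
    and k: "continuous_on {0..T} k"
  shows "bounded_on_C T (\<lambda>f. \<lambda>t\<in>{0..T}. m t * (LINT u:{0..1}|lborel. w u * (k (t - t * u) * f (t * u))))"
    (is "bounded_on_C T ?F")
proof -
  have scaled: "t * u \<in> {0..T}" "t - t * u \<in> {0..T}" if "t \<in> {0..T}" "u \<in> {0..1}" for t u
  proof -
    have "0 \<le> t * u" "t * u \<le> t"
      using that mult_left_le[of u t] by auto
    then show "t * u \<in> {0..T}" "t - t * u \<in> {0..T}"
      using that(1) unfolding atLeastAtMost_iff by linarith+
  qed
  have "?F f \<in> C_space T" if f: "f \<in> C_space T" for f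
  proof -
    have "continuous_on ({0..T} \<times> {0..1}) (\<lambda>p. k (fst p - fst p * snd p))"
      by (rule continuous_on_compose2[OF k])
        (intro continuous_intros, auto simp only: mem_Times_iff scaled fst_conv snd_conv)
    moreover have "continuous_on ({0..T} \<times> {0..1}) (\<lambda>p. f (fst p * snd p))"
      by (rule continuous_on_compose2[of "{0..T}" f])
        (use f in \<open>simp add: C_space_def\<close>, intro continuous_intros, auto simp only: mem_Times_iff scaled fst_conv snd_conv)
    ultimately have "continuous_on ({0..T} \<times> {0..1}) (\<lambda>p. k (fst p - fst p * snd p) * f (fst p * snd p))"
      by (rule continuous_on_mult)
    then have "continuous_on {0..T} (\<lambda>t. m t * (LINT u:{0..1}|lborel. w u * (k (t - t * u) * f (t * u))))"
      by (intro continuous_on_mult[OF m] continuous_on_weighted_integral[OF w]) (simp add: case_prod_unfold)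
    then show ?thesis
      by (rule restrict_in_C_space)
  qed
  moreover have "bounded (m ` {0..T})" "bounded (k ` {0..T})"
    using m k by (auto intro!: compact_imp_bounded compact_continuous_image)
  then obtain a b where a: "0 < a" "\<And>t. t \<in> {0..T} \<Longrightarrow> norm (m t) \<le> a"
    and b: "0 < b" "\<And>t. t \<in> {0..T} \<Longrightarrow> norm (k t) \<le> b"
    unfolding bounded_pos by auto
  define c where "c = (LINT u:{0..1}|lborel. norm (w u))"
  have "0 \<le> c"
    unfolding c_def set_lebesgue_integral_def by (rule Bochner_Integration.integral_nonneg) simp
  have "norm (?F f t) \<le> (a * b * c) * B"
    if f: "\<forall>t\<in>{0..T}. norm (f t) \<le> B" and t: "t \<in> {0..T}" for f B t
  proof -
    have "norm (LINT u:{0..1}|lborel. w u * (k (t - t * u) * f (t * u))) \<le> (b * B) * c"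
      unfolding c_def using w
    proof (rule norm_weighted_integral_le)
      show "norm (k (t - t * u) * f (t * u)) \<le> b * B" if "u \<in> {0..1}" for u
        using b f scaled[OF t that] by (simp add: norm_mult mult_mono)
    qed
    then show ?thesis
      using mult_mono[OF a(2)[OF t]] a(1) t by (fastforce simp: norm_mult mult_ac)
  qed
  ultimately show ?thesis
    unfolding bounded_on_C_def using a(1) b(1) \<open>0 \<le> c\<close>
    by (intro conjI exI[of _ "a * b * c"]) auto
qed

lemma bounded_on_C_cong:
  assumes "\<And>f. f \<in> C_space T \<Longrightarrow> F f = G f"
  shows "bounded_on_C T F \<longleftrightarrow> bounded_on_C T G"
  unfolding bounded_on_C_def image_subset_iff by (simp add: assms cong: ball_cong)

lemma bounded_on_C_J:
  assumes "0 < \<mu>"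
  shows "bounded_on_C T (J T \<mu>)"
proof -
  have eq: "J T \<mu> f = (\<lambda>t\<in>{0..T}. complex_of_real (t powr \<mu> / Gamma \<mu>) *
      (LINT u:{0..1}|lborel. complex_of_real ((1 - u) powr (\<mu> - 1)) * (1 * f (t * u))))" for f
    unfolding J_def
  proof (rule restrict_ext)
    fix t assume t: "t \<in> {0..T}"
    have powr: "t * t powr (\<mu> - 1) = t powr \<mu>"
      using t by (simp add: powr_mult_base)
    have "(LINT s:{0..t}|lborel. complex_of_real ((t - s) powr (\<mu> - 1)) * f s) =
        t * (LINT u:{0..1}|lborel. complex_of_real ((t - t * u) powr (\<mu> - 1)) * f (t * u))"
      using set_integral_rescale_unit[of t 0 "\<lambda>s. complex_of_real ((t - s) powr (\<mu> - 1)) * f s"] t by simp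
    also have "(LINT u:{0..1}|lborel. complex_of_real ((t - t * u) powr (\<mu> - 1)) * f (t * u)) =
        (LINT u:{0..1}|lborel. complex_of_real (t powr (\<mu> - 1)) *
          (complex_of_real ((1 - u) powr (\<mu> - 1)) * (1 * f (t * u))))"
    proof (rule set_lebesgue_integral_cong, simp, intro allI impI)
      fix u :: real assume u: "u \<in> {0..1}"
      have "(t - t * u) powr (\<mu> - 1) = t powr (\<mu> - 1) * (1 - u) powr (\<mu> - 1)"
        using t u powr_mult[of t "1 - u" "\<mu> - 1"] by (simp add: algebra_simps)
      then show "complex_of_real ((t - t * u) powr (\<mu> - 1)) * f (t * u) = complex_of_real (t powr (\<mu> - 1)) *
          (complex_of_real ((1 - u) powr (\<mu> - 1)) * (1 * f (t * u)))"
        by simp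
    qed
    finally show "complex_of_real (1 / Gamma \<mu>) * (LINT s:{0..t}|lborel. complex_of_real ((t - s) powr (\<mu> - 1)) * f s) =
        complex_of_real (t powr \<mu> / Gamma \<mu>) *
        (LINT u:{0..1}|lborel. complex_of_real ((1 - u) powr (\<mu> - 1)) * (1 * f (t * u)))"
      unfolding powr[symmetric] by simp
  qed
  have bdd: "bounded_on_C T (\<lambda>f. \<lambda>t\<in>{0..T}. complex_of_real (t powr \<mu> / Gamma \<mu>) *
      (LINT u:{0..1}|lborel. complex_of_real ((1 - u) powr (\<mu> - 1)) * (1 * f (t * u))))"
  proof (rule bounded_on_C_rescaled_integral)
    show "set_integrable lborel {0..1} (\<lambda>u. complex_of_real ((1 - u) powr (\<mu> - 1)))"
      using set_integrable_powr_times[OF assms, of 1 "\<lambda>_. 1"] by simp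
    show "continuous_on {0..T} (\<lambda>t. complex_of_real (t powr \<mu> / Gamma \<mu>))"
      using assms Gamma_real_pos[OF assms, THEN less_imp_neq]
      by (intro continuous_on_of_real continuous_on_divide continuous_on_powr' continuous_on_id
            continuous_on_const) auto
  qed (rule continuous_on_const)
  show ?thesis
    by (rule bounded_on_C_cong[THEN iffD2, OF _ bdd]) (rule eq)
qed

lemma bounded_on_C_V_convolution:
  assumes "k \<in> C_space T"
  shows "bounded_on_C T (V T (\<lambda>t s. k (t - s)))"
proof -
  have eq: "V T (\<lambda>t s. k (t - s)) f = (\<lambda>t\<in>{0..T}. complex_of_real t *
      (LINT u:{0..1}|lborel. 1 * (k (t - t * u) * f (t * u))))" for f
    unfolding V_def
    using set_integral_rescale_unit[of _ 0 "\<lambda>s. k (_ - s) * f s"] by (intro restrict_ext) simp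
  have bdd: "bounded_on_C T (\<lambda>f. \<lambda>t\<in>{0..T}. complex_of_real t *
      (LINT u:{0..1}|lborel. 1 * (k (t - t * u) * f (t * u))))"
    using assms by (intro bounded_on_C_rescaled_integral borel_integrable_atLeastAtMost' continuous_intros)
      (auto simp: C_space_def)
  show ?thesis
    by (rule bounded_on_C_cong[THEN iffD2, OF _ bdd]) (rule eq)
qed

lemma bounded_on_C_Mult:
  assumes "bounded_on_C T F"
  shows "bounded_on_C T (\<lambda>f. Mult T p (F f))"
proof -
  have p: "continuous_on {0..T} (\<lambda>t. poly p (complex_of_real t))"
    by (intro continuous_intros)
  then have "bounded ((\<lambda>t. poly p (complex_of_real t)) ` {0..T})"
    by (intro compact_imp_bounded compact_continuous_image) auto
  then obtain a where a: "0 < a" "\<And>t. t \<in> {0..T} \<Longrightarrow> norm (poly p (complex_of_real t)) \<le> a"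
    unfolding bounded_pos by auto
  obtain c where c: "0 \<le> c" "\<And>f B t. f \<in> C_space T \<Longrightarrow> (\<forall>t\<in>{0..T}. norm (f t) \<le> B) \<Longrightarrow>
      t \<in> {0..T} \<Longrightarrow> norm (F f t) \<le> c * B"
    using assms unfolding bounded_on_C_def by blast
  have "norm (Mult T p (F f) t) \<le> (a * c) * B"
    if "f \<in> C_space T" "\<forall>t\<in>{0..T}. norm (f t) \<le> B" "t \<in> {0..T}" for f B t
    using mult_mono[OF a(2)[OF that(3)] c(2)[OF that]] a(1) that(3) by (simp add: Mult_def norm_mult mult_ac)
  moreover have "Mult T p (F f) \<in> C_space T" if "f \<in> C_space T" for f
  proof -
    have "continuous_on {0..T} (\<lambda>t. poly p (complex_of_real t) * F f t)"
      using assms that by (intro continuous_on_mult p) (auto simp: bounded_on_C_def C_space_def)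
    then show ?thesis
      unfolding Mult_def by (rule restrict_in_C_space)
  qed
  ultimately show ?thesis
    using a(1) c(1) unfolding bounded_on_C_def by (intro conjI exI[of _ "a * c"]) auto
qed

lemma bounded_on_C_add:
  assumes "bounded_on_C T F" "bounded_on_C T G"
  shows "bounded_on_C T (\<lambda>f. \<lambda>t\<in>{0..T}. F f t + G f t)"
proof -
  obtain a where a: "0 \<le> a" "\<And>f B t. f \<in> C_space T \<Longrightarrow> (\<forall>t\<in>{0..T}. norm (f t) \<le> B) \<Longrightarrow>
      t \<in> {0..T} \<Longrightarrow> norm (F f t) \<le> a * B"
    using assms(1) unfolding bounded_on_C_def by blast
  obtain b where b: "0 \<le> b" "\<And>f B t. f \<in> C_space T \<Longrightarrow> (\<forall>t\<in>{0..T}. norm (f t) \<le> B) \<Longrightarrow>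
      t \<in> {0..T} \<Longrightarrow> norm (G f t) \<le> b * B"
    using assms(2) unfolding bounded_on_C_def by blast
  have "norm (F f t + G f t) \<le> (a + b) * B"
    if "f \<in> C_space T" "\<forall>t\<in>{0..T}. norm (f t) \<le> B" "t \<in> {0..T}" for f B t
    using norm_triangle_ineq[of "F f t" "G f t"] a(2)[OF that] b(2)[OF that]
    by (simp add: distrib_right)
  moreover have "(\<lambda>t\<in>{0..T}. F f t + G f t) \<in> C_space T" if "f \<in> C_space T" for f
  proof -
    have "continuous_on {0..T} (\<lambda>t. F f t + G f t)"
      using assms that by (intro continuous_on_add) (auto simp: bounded_on_C_def C_space_def)
    then show ?thesis
      by (rule restrict_in_C_space)
  qed
  ultimately show ?thesis
    using a(1) b(1) unfolding bounded_on_C_def by (intro conjI exI[of _ "a + b"]) auto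
qed

lemma bounded_on_C_sum:
  assumes "finite I" "\<And>i. i \<in> I \<Longrightarrow> bounded_on_C T (F i)"
  shows "bounded_on_C T (\<lambda>f. \<lambda>t\<in>{0..T}. \<Sum>i\<in>I. F i f t)"
  using assms
proof (induction I)
  case empty
  show ?case
    using restrict_in_C_space[of T "\<lambda>_. 0"] unfolding bounded_on_C_def by (auto intro!: exI[of _ 0])
next
  case (insert i I)
  then have "bounded_on_C T (\<lambda>f. \<lambda>t\<in>{0..T}. F i f t + (\<lambda>t\<in>{0..T}. \<Sum>i\<in>I. F i f t) t)"
    by (intro bounded_on_C_add) auto
  moreover have "(\<lambda>f. \<lambda>t\<in>{0..T}. F i f t + (\<lambda>t\<in>{0..T}. \<Sum>i\<in>I. F i f t) t) =
      (\<lambda>f. \<lambda>t\<in>{0..T}. \<Sum>i\<in>insert i I. F i f t)"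
    using insert.hyps by (auto simp: fun_eq_iff)
  ultimately show ?case
    by (simp only:)
qed

lemma bounded_on_C_compose:
  assumes "bounded_on_C T F" "bounded_on_C T G"
  shows "bounded_on_C T (\<lambda>f. F (G f))"
proof -
  obtain a where a: "0 \<le> a" "\<And>f B t. f \<in> C_space T \<Longrightarrow> (\<forall>t\<in>{0..T}. norm (f t) \<le> B) \<Longrightarrow>
      t \<in> {0..T} \<Longrightarrow> norm (F f t) \<le> a * B"
    using assms(1) unfolding bounded_on_C_def by blast
  obtain b where b: "0 \<le> b" "\<And>f B t. f \<in> C_space T \<Longrightarrow> (\<forall>t\<in>{0..T}. norm (f t) \<le> B) \<Longrightarrow>
      t \<in> {0..T} \<Longrightarrow> norm (G f t) \<le> b * B"
    using assms(2) unfolding bounded_on_C_def by blast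
  have G: "G f \<in> C_space T" if "f \<in> C_space T" for f
    using assms(2) that by (auto simp: bounded_on_C_def)
  have "norm (F (G f) t) \<le> (a * b) * B"
    if "f \<in> C_space T" "\<forall>t\<in>{0..T}. norm (f t) \<le> B" "t \<in> {0..T}" for f B t
    using a(2)[OF G, of f "b * B" t] b(2)[of f B] that by (simp add: mult.assoc)
  moreover have "F (G f) \<in> C_space T" if "f \<in> C_space T" for f
    using assms that by (auto simp: bounded_on_C_def)
  ultimately show ?thesis
    using a(1) b(1) unfolding bounded_on_C_def by (intro conjI exI[of _ "a * b"]) auto
qed

lemma bounded_on_C_sup_norm:
  assumes "0 \<le> T" "bounded_on_C T F"
  shows "\<exists>C. \<forall>f\<in>C_space T. sup_norm T (F f) \<le> C * sup_norm T f"
proof -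
  obtain c where c: "\<And>f B t. f \<in> C_space T \<Longrightarrow> (\<forall>t\<in>{0..T}. norm (f t) \<le> B) \<Longrightarrow>
      t \<in> {0..T} \<Longrightarrow> norm (F f t) \<le> c * B"
    using assms(2) unfolding bounded_on_C_def by blast
  have "sup_norm T (F f) \<le> c * sup_norm T f" if f: "f \<in> C_space T" for f
  proof -
    have "continuous_on {0..T} (\<lambda>t. norm (f t))"
      using f by (intro continuous_on_norm) (auto simp: C_space_def)
    then have "bdd_above ((\<lambda>t. norm (f t)) ` {0..T})"
      by (intro bounded_imp_bdd_above compact_imp_bounded compact_continuous_image) auto
    then have "\<forall>t\<in>{0..T}. norm (f t) \<le> sup_norm T f"
      unfolding sup_norm_def by (auto intro: cSUP_upper)
    then have "norm (F f t) \<le> c * sup_norm T f" if "t \<in> {0..T}" for t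
      using c f that by blast
    then show ?thesis
      unfolding sup_norm_def[of T "F f"] using assms(1) by (intro cSUP_least) auto
  qed
  then show ?thesis by blast
qed

section \<open>Primitives and injectivity\<close>

text \<open>
  Since \<open>0 powr 0 = 0\<close>, the integrand of \<open>J T 1\<close> differs from \<open>f\<close> only at the end point \<open>s = t\<close>, which
  is a null set.
\<close>
lemma J_one:
  assumes "f \<in> C_space T"
  shows "J T 1 f = (\<lambda>t\<in>{0..T}. integral {0..t} f)"
  unfolding J_def
proof (rule restrict_ext)
  fix t assume t: "t \<in> {0..T}"
  have "set_integrable lborel {0..t} (\<lambda>s. complex_of_real ((t - s) powr (1 - 1)) * f s)"
    using t by (intro set_integrable_powr_times C_space_continuous_on_subset[OF assms]) auto
  then have "(LINT s:{0..t}|lborel. complex_of_real ((t - s) powr (1 - 1)) * f s) =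
      integral {0..t} (\<lambda>s. complex_of_real ((t - s) powr (1 - 1)) * f s)"
    by (rule set_borel_integral_eq_integral)
  also have "\<dots> = integral {0..t} f"
    by (rule integral_spike[of "{t}"]) auto
  finally show "complex_of_real (1 / Gamma 1) *
      (LINT s:{0..t}|lborel. complex_of_real ((t - s) powr (1 - 1)) * f s) = integral {0..t} f"
    by simp
qed

lemma J_one_has_vector_derivative:
  assumes "f \<in> C_space T" "t \<in> {0..T}"
  shows "(J T 1 f has_vector_derivative f t) (at t within {0..T})"
proof (rule has_vector_derivative_transform)
  show "((\<lambda>t. integral {0..t} f) has_vector_derivative f t) (at t within {0..T})"
    using assms by (intro integral_has_vector_derivative) (auto simp: C_space_def)
qed (use assms in \<open>auto simp: J_one\<close>)

lemma deriv_on_J_one: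
  assumes "0 < T" "f \<in> C_space T"
  shows "deriv_on T (J T 1 f) = f"
proof
  fix t
  show "deriv_on T (J T 1 f) t = f t"
  proof (cases "t \<in> {0..T}")
    case True
    then show ?thesis
      using vector_derivative_within_cbox[of 0 T t "J T 1 f" "f t"] assms
      by (simp add: deriv_on_def J_one_has_vector_derivative)
  next
    case False
    then show ?thesis
      using assms(2) by (auto simp: deriv_on_def C_space_def extensional_def)
  qed
qed

lemma J_one_deriv_on:
  assumes "f \<in> flat_space T"
  shows "J T 1 (deriv_on T f) = f"
proof
  fix t
  have f': "deriv_on T f \<in> C_space T"
    using flat_space_deriv_on[OF assms] flat_space_subset_C_space by blast
  show "J T 1 (deriv_on T f) t = f t"
  proof (cases "t \<in> {0..T}")
    case True
    have "(deriv_on T f has_integral f t - f 0) {0..t}"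
    proof (rule fundamental_theorem_of_calculus_interior)
      show "continuous_on {0..t} f"
        using flat_space_continuous[OF assms] by (rule continuous_on_subset) (use True in auto)
    qed (use True flat_space_has_vector_derivative[OF assms] in auto)
    then show ?thesis
      using True flat_space_zero[OF assms] by (simp add: J_one[OF f'] integral_unique)
  next
    case False
    then show ?thesis
      using assms by (auto simp: J_def flat_space_def extensional_def)
  qed
qed

lemma J_in_C_space: "0 < \<mu> \<Longrightarrow> f \<in> C_space T \<Longrightarrow> J T \<mu> f \<in> C_space T"
  using bounded_on_C_J unfolding bounded_on_C_def by blast

text \<open>
  \<open>J\<^sup>1\<close> is injective because differentiation inverts it, hence so is its iterate \<open>J\<^sup>n\<close>. For
  \<open>n > \<alpha>\<close>, \<open>J\<^sup>n\<close> factors as \<open>J\<^bsup>n-\<alpha>\<^esup> J\<^sup>\<alpha>\<close>, and the first map of an injective composition is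
  injective.
\<close>
lemma inj_on_J:
  assumes "0 < T" "0 < \<alpha>"
  shows "inj_on (J T \<alpha>) (C_space T)"
proof -
  have one: "inj_on (J T 1) (C_space T)"
    by (rule inj_on_inverseI) (rule deriv_on_J_one[OF assms(1)])
  have Suc: "inj_on (J T (real (Suc n))) (C_space T)" for n
  proof (induction n)
    case 0
    show ?case using one by simp
  next
    case (Suc n)
    have "J T (real (Suc (Suc n))) f = (J T 1 \<circ> J T (real (Suc n))) f" if "f \<in> C_space T" for f
      using J_J[of "real (Suc n)" 1 f T] that by (simp add: add.commute)
    moreover have "inj_on (J T 1 \<circ> J T (real (Suc n))) (C_space T)"
      by (intro comp_inj_on Suc inj_on_subset[OF one]) (use J_in_C_space in auto)
    ultimately show ?case
      by (simp cong: inj_on_cong)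
  qed
  obtain n where n: "\<alpha> < real (Suc n)"
    using reals_Archimedean2[of \<alpha>] by (metis less_trans lessI of_nat_less_iff)
  have "J T (real (Suc n)) f = (J T (real (Suc n) - \<alpha>) \<circ> J T \<alpha>) f" if "f \<in> C_space T" for f
    using J_J[of \<alpha> "real (Suc n) - \<alpha>" f T] that n assms(2) by simp
  then have "inj_on (J T (real (Suc n) - \<alpha>) \<circ> J T \<alpha>) (C_space T)"
    using Suc[of n] by (simp cong: inj_on_cong)
  then show ?thesis
    by (rule inj_on_imageI2)
qed

section \<open>Fractional calculus on flat functions\<close>

lemma J_at_zero: "0 \<le> T \<Longrightarrow> J T \<mu> f 0 = 0"
  using set_integral_rescale_unit[of 0 0 "\<lambda>s. h \<mu> (0 - s) * f s"] by (simp add: J_eq_h_convolution)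

text \<open>
  Writing \<open>J\<^sup>\<mu> f\<close> as the primitive of \<open>J\<^sup>\<mu> f'\<close> is how differentiability of \<open>J\<^sup>\<mu> f\<close>, and the rule
  \<open>(J\<^sup>\<mu> f)' = J\<^sup>\<mu> f'\<close>, are obtained without differentiating under the singular integral.
\<close>
lemma J_eq_J_one_J_deriv_on:
  assumes "0 < \<mu>" "f \<in> flat_space T"
  shows "J T \<mu> f = J T 1 (J T \<mu> (deriv_on T f))"
proof -
  have "deriv_on T f \<in> C_space T"
    using flat_space_deriv_on[OF assms(2)] flat_space_subset_C_space by blast
  from J_J[OF assms(1) _ this, of 1] show ?thesis
    using J_Suc_deriv_on[OF assms] by (simp add: add.commute)
qed

lemma J_in_flat_space:
  assumes "0 < T" "0 < \<mu>" "f \<in> flat_space T"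
  shows "J T \<mu> f \<in> flat_space T"
proof -
  have f': "J T \<mu> (deriv_on T g) \<in> C_space T" if "g \<in> flat_space T" for g
    using J_in_C_space[OF assms(2)] flat_space_deriv_on[OF that] flat_space_subset_C_space by blast
  have funpow: "(deriv_on T ^^ n) (J T \<mu> f) = J T \<mu> ((deriv_on T ^^ n) f)" for n
  proof (induction n)
    case (Suc n)
    have g: "(deriv_on T ^^ n) f \<in> flat_space T"
      by (rule flat_space_funpow_deriv_on[OF assms(3)])
    show ?case
      using Suc deriv_on_J_one[OF assms(1) f'[OF g]] by (simp flip: J_eq_J_one_J_deriv_on[OF assms(2) g])
  qed simp
  have "J T \<mu> g differentiable_on {0..T}" if "g \<in> flat_space T" for g
    unfolding J_eq_J_one_J_deriv_on[OF assms(2) that] differentiable_on_def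
    using J_one_has_vector_derivative[OF f'[OF that]] differentiableI_vector by blast
  then show ?thesis
    using assms(1) flat_space_funpow_deriv_on[OF assms(3)]
    unfolding flat_space_def by (auto simp: funpow J_at_zero) (simp add: J_def)
qed

text \<open>
  Taylor's formula with integral remainder at \<open>0\<close>: all Taylor coefficients of a flat function vanish.
\<close>
lemma J_funpow_deriv_on:
  assumes "f \<in> flat_space T"
  shows "J T (real (Suc n)) ((deriv_on T ^^ Suc n) f) = f"
proof (induction n)
  case 0
  show ?case using J_one_deriv_on[OF assms] by simp
next
  case (Suc n)
  have "J T (real (Suc n) + 1) (deriv_on T ((deriv_on T ^^ Suc n) f)) = J T (real (Suc n)) ((deriv_on T ^^ Suc n) f)"
    by (intro J_Suc_deriv_on flat_space_funpow_deriv_on assms) simp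
  with Suc show ?case
    by (simp add: add.commute)
qed

lemma D_eq_J_Suc:
  assumes "0 < \<alpha>"
  obtains n where "\<alpha> < real (Suc n)"
    and "\<And>f. f \<in> flat_space T \<Longrightarrow> D T \<alpha> f = J T (real (Suc n) - \<alpha>) ((deriv_on T ^^ Suc n) f)"
proof -
  obtain n where "\<alpha> < real (Suc n)"
    using reals_Archimedean2[of \<alpha>] by (metis less_trans lessI of_nat_less_iff)
  then show thesis
    using that D_eq assms by blast
qed

lemma D_in_flat_space:
  assumes "0 < T" "0 < \<alpha>" "f \<in> flat_space T"
  shows "D T \<alpha> f \<in> flat_space T"
  using D_eq_J_Suc[OF assms(2), of T] J_in_flat_space[OF assms(1)] flat_space_funpow_deriv_on[OF assms(3)] assms(3)
  by (metis diff_gt_0_iff_gt)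

text \<open>
  The algebraic heart of the factorization. With \<open>n > \<alpha>\<close> and \<open>g\<close> the \<open>n\<close>-th derivative of \<open>f\<close>,
  both sides equal \<open>J\<^bsup>n-\<beta>\<^esup> g\<close>: the left side by the semigroup law, the right side by \<open>D_eq\<close>
  if \<open>\<beta> > 0\<close>, and because \<open>f = J\<^sup>n g\<close> otherwise.
\<close>
lemma J_D_eq_D:
  assumes "0 < T" "0 < \<alpha>" "\<beta> < \<alpha>" "f \<in> flat_space T"
  shows "J T (\<alpha> - \<beta>) (D T \<alpha> f) = D T \<beta> f"
proof -
  obtain n where n: "\<alpha> < real (Suc n)"
    and D: "D T \<alpha> f = J T (real (Suc n) - \<alpha>) ((deriv_on T ^^ Suc n) f)"
    using D_eq_J_Suc[OF assms(2)] assms(4) by metis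
  define g where "g = (deriv_on T ^^ Suc n) f"
  have g: "g \<in> C_space T"
    unfolding g_def using flat_space_funpow_deriv_on[OF assms(4)] flat_space_subset_C_space by blast
  have f: "J T (real (Suc n)) g = f"
    unfolding g_def by (rule J_funpow_deriv_on[OF assms(4)])
  have "J T (\<alpha> - \<beta>) (D T \<alpha> f) = J T (real (Suc n) - \<beta>) g"
    using J_J[OF _ _ g, of "real (Suc n) - \<alpha>" "\<alpha> - \<beta>"] n assms(3) by (simp add: D g_def)
  also have "\<dots> = D T \<beta> f"
  proof -
    consider "\<beta> < 0" | "\<beta> = 0" | "0 < \<beta>" by linarith
    then show ?thesis
    proof cases
      case 1
      then show ?thesis
        using J_J[OF _ _ g, of "real (Suc n)" "- \<beta>"] by (simp add: D_def f del: of_nat_Suc)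
    next
      case 2
      then show ?thesis
        using f by (simp add: D_def)
    next
      case 3
      then show ?thesis
        using D_eq[OF assms(4), of \<beta> "Suc n"] n assms(3) by (simp add: g_def)
    qed
  qed
  finally show ?thesis .
qed

lemma J_D:
  assumes "0 < T" "0 < \<alpha>" "f \<in> flat_space T"
  shows "J T \<alpha> (D T \<alpha> f) = f"
  using J_D_eq_D[OF assms(1,2,2,3)] by (simp add: D_def)

lemma A_op_eq_D:
  assumes "0 < T" "0 < \<alpha>" "f \<in> flat_space T"
  shows "A_op T \<alpha> f = D T \<alpha> f"
proof -
  have D: "D T \<alpha> f \<in> C_space T"
    using D_in_flat_space[OF assms] flat_space_subset_C_space by blast
  then have "f \<in> J T \<alpha> ` C_space T"
    using J_D[OF assms] by (metis imageI)
  moreover have "inv_into (C_space T) (J T \<alpha>) f = D T \<alpha> f"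
    using inv_into_f_f[OF inj_on_J[OF assms(1,2)] D] by (simp add: J_D[OF assms])
  ultimately show ?thesis
    by (simp add: A_op_def)
qed

section \<open>Volterra operators with flat kernels and their right factors\<close>

lemma flat_kernel_continuous_on:
  assumes "K \<in> flat_kernels T" "t \<in> {0..T}"
  shows "continuous_on {0..t} (K t)"
proof -
  obtain N :: nat and q k where k: "\<And>r. r \<in> {1..N} \<Longrightarrow> k r \<in> flat_space T"
    and K: "\<And>t s. 0 \<le> s \<and> s \<le> t \<and> t \<le> T \<Longrightarrow> K t s = (\<Sum>r=1..N. poly (q r) (complex_of_real t) * k r (t - s))"
    using assms(1) unfolding flat_kernels_def by blast
  have "continuous_on {0..t} (\<lambda>s. k r (t - s))" if "r \<in> {1..N}" for r
    by (rule continuous_on_compose2[OF flat_space_continuous[OF k[OF that]]])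
      (use assms(2) in \<open>auto intro!: continuous_intros\<close>)
  then have "continuous_on {0..t} (\<lambda>s. \<Sum>r=1..N. poly (q r) (complex_of_real t) * k r (t - s))"
    by (intro continuous_on_sum continuous_on_mult continuous_on_const) auto
  then show ?thesis
    by (rule continuous_on_eq) (use assms(2) K in auto)
qed

text \<open>A flat kernel acts as a finite sum of convolutions followed by multiplications by polynomials.\<close>
lemma bounded_on_C_V_flat_kernel:
  assumes "K \<in> flat_kernels T"
  shows "bounded_on_C T (V T K)"
proof -
  obtain N :: nat and q k where k: "\<And>r. r \<in> {1..N} \<Longrightarrow> k r \<in> flat_space T"
    and K: "\<And>t s. 0 \<le> s \<and> s \<le> t \<and> t \<le> T \<Longrightarrow> K t s = (\<Sum>r=1..N. poly (q r) (complex_of_real t) * k r (t - s))"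
    using assms unfolding flat_kernels_def by blast
  have "bounded_on_C T (V T (\<lambda>t s. k r (t - s)))" if "r \<in> {1..N}" for r
    using k[OF that] flat_space_subset_C_space by (intro bounded_on_C_V_convolution) blast
  then have bdd: "bounded_on_C T (\<lambda>f. \<lambda>t\<in>{0..T}. \<Sum>r=1..N. Mult T (q r) (V T (\<lambda>t s. k r (t - s)) f) t)"
    by (intro bounded_on_C_sum bounded_on_C_Mult) auto
  have eq: "V T K f = (\<lambda>t\<in>{0..T}. \<Sum>r=1..N. Mult T (q r) (V T (\<lambda>t s. k r (t - s)) f) t)"
    if f: "f \<in> C_space T" for f
    unfolding V_def[of T K]
  proof (rule restrict_ext)
    fix t assume t: "t \<in> {0..T}"
    have int: "set_integrable lborel {0..t} (\<lambda>s. k r (t - s) * f s)" if "r \<in> {1..N}" for r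
    proof (intro borel_integrable_atLeastAtMost' continuous_on_mult)
      show "continuous_on {0..t} (\<lambda>s. k r (t - s))"
        by (rule continuous_on_compose2[OF flat_space_continuous[OF k[OF that]]])
          (use t in \<open>auto intro!: continuous_intros\<close>)
    qed (use C_space_continuous_on_subset[OF f] t in auto)
    have "(LINT s:{0..t}|lborel. K t s * f s) =
        (LINT s:{0..t}|lborel. (\<Sum>r=1..N. poly (q r) (complex_of_real t) * (k r (t - s) * f s)))"
      by (intro set_lebesgue_integral_cong) (use t K in \<open>auto simp: sum_distrib_right mult.assoc\<close>)
    also have "\<dots> = (\<Sum>r=1..N. LINT s:{0..t}|lborel. poly (q r) (complex_of_real t) * (k r (t - s) * f s))"
      unfolding set_lebesgue_integral_def scaleR_sum_right
      by (intro Bochner_Integration.integral_sum) (use int in \<open>auto simp flip: set_integrable_def\<close>)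
    finally show "(LINT s:{0..t}|lborel. K t s * f s) =
        (\<Sum>r=1..N. Mult T (q r) (V T (\<lambda>t s. k r (t - s)) f) t)"
      using t by (simp add: Mult_def V_def)
  qed
  show ?thesis
    by (rule bounded_on_C_cong[THEN iffD2, OF _ bdd]) (rule eq)
qed

text \<open>
  The first sum in \<open>G0\<close> is the kernel of the terms \<open>Mult (p j) (J (\<alpha> - \<beta> j) f)\<close> by linearity; its
  integral term is the kernel of \<open>V K\<close> after \<open>J\<^sup>\<alpha>\<close> by Fubini on the triangle. The hypothesis
  \<open>\<beta> j < \<alpha>\<close> makes the singularities \<open>h (\<alpha> - \<beta> j) (t - s)\<close> integrable.
\<close>
lemma
  assumes \<alpha>: "0 < \<alpha>" and \<beta>: "\<And>j. j \<in> {1..N} \<Longrightarrow> \<beta> j < \<alpha>"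
    and K: "continuous_on {0..t} (K t)" and f: "f \<in> C_space T" and t: "t \<in> {0..T}"
  shows set_integrable_G0: "set_integrable lborel {0..t} (\<lambda>s. G0 \<alpha> N p \<beta> K t s * f s)"
    and V_G0_eq: "V T (G0 \<alpha> N p \<beta> K) f t =
      (\<Sum>j=1..N. Mult T (p j) (J T (\<alpha> - \<beta> j) f) t) + V T K (J T \<alpha> f) t"
proof -
  let ?c = "\<lambda>j. poly (p j) (complex_of_real t)"
  let ?H = "\<lambda>j s. ?c j * (h (\<alpha> - \<beta> j) (t - s) * f s)"
  let ?K = "\<lambda>s. (LINT \<xi>:{s..t}|lborel. K t \<xi> * h \<alpha> (\<xi> - s)) * f s"
  have f_t: "continuous_on {0..t} f" and "0 \<le> t"
    using t C_space_continuous_on_subset[OF f] by auto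
  note kernel = borel_integrable_atLeastAtMost'[OF K] set_integrable_h(1)[OF \<alpha> \<open>0 \<le> t\<close>] f_t
  have intK: "set_integrable lborel {0..t} ?K"
    by (rule set_integrable_composed_kernel[OF kernel])
  have intH: "set_integrable lborel {0..t} (?H j)" if "j \<in> {1..N}" for j
    using set_integrable_h_times[OF _ \<open>0 \<le> t\<close> f_t] \<beta>[OF that] by simp
  then have sumH: "set_integrable lborel {0..t} (\<lambda>s. \<Sum>j=1..N. ?H j s)"
    unfolding set_integrable_def scaleR_sum_right by (intro Bochner_Integration.integrable_sum) auto
  have G0: "G0 \<alpha> N p \<beta> K t s * f s = (\<Sum>j=1..N. ?H j s) + ?K s" for s
    by (simp add: G0_def distrib_right sum_distrib_right mult.assoc)
  show "set_integrable lborel {0..t} (\<lambda>s. G0 \<alpha> N p \<beta> K t s * f s)"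
    unfolding G0 using sumH intK by (rule set_integral_add)
  have "V T (G0 \<alpha> N p \<beta> K) f t = (LINT s:{0..t}|lborel. \<Sum>j=1..N. ?H j s) + (LINT s:{0..t}|lborel. ?K s)"
    using t set_integral_add(2)[OF sumH intK] by (simp add: V_def G0)
  also have "(LINT s:{0..t}|lborel. \<Sum>j=1..N. ?H j s) = (\<Sum>j=1..N. LINT s:{0..t}|lborel. ?H j s)"
    unfolding set_lebesgue_integral_def scaleR_sum_right
    by (intro Bochner_Integration.integral_sum) (use intH in \<open>simp add: set_integrable_def\<close>)
  also have "\<dots> = (\<Sum>j=1..N. Mult T (p j) (J T (\<alpha> - \<beta> j) f) t)"
    using t by (simp add: Mult_def J_eq_h_convolution)
  also have "(LINT s:{0..t}|lborel. ?K s) =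
      (LINT \<xi>:{0..t}|lborel. K t \<xi> * (LINT s:{0..\<xi>}|lborel. h \<alpha> (\<xi> - s) * f s))"
    by (rule set_integral_triangle_swap[OF kernel, symmetric])
  also have "\<dots> = V T K (J T \<alpha> f) t"
    using t unfolding V_def
    by (simp, intro set_lebesgue_integral_cong) (auto simp: J_eq_h_convolution)
  finally show "V T (G0 \<alpha> N p \<beta> K) f t =
      (\<Sum>j=1..N. Mult T (p j) (J T (\<alpha> - \<beta> j) f) t) + V T K (J T \<alpha> f) t" .
qed

lemma bounded_VolterraI:
  assumes "0 \<le> T" "bounded_on_C T (V T K)"
    and int: "\<And>f t. f \<in> C_space T \<Longrightarrow> t \<in> {0..T} \<Longrightarrow> set_integrable lborel {0..t} (\<lambda>s. K t s * f s)"
  shows "bounded_Volterra T K"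
  unfolding bounded_Volterra_def
proof (intro conjI ballI allI)
  show "V T K ` C_space T \<subseteq> C_space T"
    using assms(2) by (simp add: bounded_on_C_def)
  show "\<exists>C. \<forall>f\<in>C_space T. sup_norm T (V T K f) \<le> C * sup_norm T f"
    by (rule bounded_on_C_sup_norm[OF assms(1,2)])
next
  fix f g a b assume fg: "f \<in> C_space T" "g \<in> C_space T"
  show "V T K (\<lambda>t\<in>{0..T}. a * f t + b * g t) = (\<lambda>t\<in>{0..T}. a * V T K f t + b * V T K g t)"
    unfolding V_def
  proof (rule restrict_ext)
    fix t assume t: "t \<in> {0..T}"
    have "(LINT s:{0..t}|lborel. K t s * (\<lambda>t\<in>{0..T}. a * f t + b * g t) s) =
        (LINT s:{0..t}|lborel. a * (K t s * f s) + b * (K t s * g s))"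
      by (intro set_lebesgue_integral_cong) (use t in \<open>auto simp: algebra_simps\<close>)
    also have "\<dots> = a * (LINT s:{0..t}|lborel. K t s * f s) + b * (LINT s:{0..t}|lborel. K t s * g s)"
      using int fg t by (subst set_integral_add) auto
    finally show "(LINT s:{0..t}|lborel. K t s * (\<lambda>t\<in>{0..T}. a * f t + b * g t) s) =
        a * (\<lambda>t\<in>{0..T}. LINT s:{0..t}|lborel. K t s * f s) t +
        b * (\<lambda>t\<in>{0..T}. LINT s:{0..t}|lborel. K t s * g s) t"
      using t by simp
  qed
qed (use int in auto)

lemma bounded_Volterra_G0:
  assumes "0 < T" "0 < \<alpha>" "\<And>j. j \<in> {1..N} \<Longrightarrow> \<beta> j < \<alpha>" "K \<in> flat_kernels T"
  shows "bounded_Volterra T (G0 \<alpha> N p \<beta> K)"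
proof (rule bounded_VolterraI)
  have "bounded_on_C T (\<lambda>f. \<lambda>t\<in>{0..T}. \<Sum>j=1..N. Mult T (p j) (J T (\<alpha> - \<beta> j) f) t)"
    using assms(3) by (intro bounded_on_C_sum bounded_on_C_Mult bounded_on_C_J) auto
  from bounded_on_C_add[OF this bounded_on_C_compose[OF bounded_on_C_V_flat_kernel[OF assms(4)] bounded_on_C_J[OF assms(2)]]]
  show "bounded_on_C T (V T (G0 \<alpha> N p \<beta> K))"
  proof (rule bounded_on_C_cong[THEN iffD2, rotated])
    fix f assume f: "f \<in> C_space T"
    show "V T (G0 \<alpha> N p \<beta> K) f = (\<lambda>t\<in>{0..T}.
        (\<lambda>t\<in>{0..T}. \<Sum>j=1..N. Mult T (p j) (J T (\<alpha> - \<beta> j) f) t) t + V T K (J T \<alpha> f) t)"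
    proof
      fix t
      show "V T (G0 \<alpha> N p \<beta> K) f t = (\<lambda>t\<in>{0..T}.
        (\<lambda>t\<in>{0..T}. \<Sum>j=1..N. Mult T (p j) (J T (\<alpha> - \<beta> j) f) t) t + V T K (J T \<alpha> f) t) t"
      proof (cases "t \<in> {0..T}")
        case True
        then show ?thesis
          using V_G0_eq[where K = K and t = t, OF assms(2,3) flat_kernel_continuous_on[OF assms(4)] f] by simp
      qed (auto simp: V_def)
    qed
  qed
next
  fix f t assume "f \<in> C_space T" and t: "t \<in> {0..T}"
  then show "set_integrable lborel {0..t} (\<lambda>s. G0 \<alpha> N p \<beta> K t s * f s)"
    by (intro set_integrable_G0[where K = K and t = t, OF assms(2,3) flat_kernel_continuous_on[OF assms(4) t]])
qed (use assms(1) in simp)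

section \<open>The right factorization and the extension\<close>

theorem proposition3:
  fixes T \<alpha> :: real and \<Gamma> :: "real set" and N :: nat
    and p :: "nat \<Rightarrow> complex poly" and \<beta> :: "nat \<Rightarrow> real" and K0 :: "real \<Rightarrow> real \<Rightarrow> complex"
  assumes T: "0 < T"
    and \<Gamma>_subgroup: "0 \<in> \<Gamma>" "\<And>x y. x \<in> \<Gamma> \<Longrightarrow> y \<in> \<Gamma> \<Longrightarrow> x + y \<in> \<Gamma>" "\<And>x. x \<in> \<Gamma> \<Longrightarrow> - x \<in> \<Gamma>"
    and \<Gamma>_Ints: "\<int> \<subseteq> \<Gamma>"
    and \<alpha>: "\<alpha> \<in> \<Gamma>" "0 < \<alpha>"
    and \<beta>: "\<And>j. j \<in> {1..N} \<Longrightarrow> \<beta> j \<in> \<Gamma>" "\<And>j. j \<in> {1..N} \<Longrightarrow> \<beta> j < \<alpha>"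
    and K0: "K0 \<in> flat_kernels T"
  shows
    "(J T \<alpha> ` C_space T \<subseteq> C_space T \<and> inj_on (J T \<alpha>) (C_space T)) \<and>
     (flat_space T = J T \<alpha> ` flat_space T \<and>
      J T \<alpha> ` flat_space T \<subseteq> J T \<alpha> ` C_space T \<and>
      restrict (A_op T \<alpha>) (flat_space T) = restrict (D T \<alpha>) (flat_space T)) \<and>
     (flat_space T \<subseteq> C_space T \<and>
      bounded_Volterra T (G0 \<alpha> N p \<beta> K0) \<and>
      restrict (V T (G0 \<alpha> N p \<beta> K0)) (flat_space T) = W0 T \<alpha> N p \<beta> K0) \<and>
     ((\<forall>f\<in>flat_space T. D T \<alpha> f \<in> flat_space T \<and>
         L0 T \<alpha> N p \<beta> K0 f = (\<lambda>t\<in>{0..T}. D T \<alpha> f t + W0 T \<alpha> N p \<beta> K0 (D T \<alpha> f) t)) \<and>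
      flat_space T \<subseteq> J T \<alpha> ` C_space T \<and>
      restrict (L0_tilde T \<alpha> N p \<beta> K0) (flat_space T) = L0 T \<alpha> N p \<beta> K0)"
proof -
  let ?G = "G0 \<alpha> N p \<beta> K0"
  note D_flat = D_in_flat_space[OF T \<alpha>(2)]
  have flat_eq: "flat_space T = J T \<alpha> ` flat_space T"
    using J_in_flat_space[OF T \<alpha>(2)] J_D[OF T \<alpha>(2), symmetric] D_flat by blast
  have image_mono: "J T \<alpha> ` flat_space T \<subseteq> J T \<alpha> ` C_space T"
    by (intro image_mono flat_space_subset_C_space)
  have V_eq: "V T ?G f = W0 T \<alpha> N p \<beta> K0 f" if "f \<in> flat_space T" for f
  proof
    fix t
    show "V T ?G f t = W0 T \<alpha> N p \<beta> K0 f t"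
    proof (cases "t \<in> {0..T}")
      case True
      then show ?thesis
        using V_G0_eq[where K = K0 and t = t and N = N and \<beta> = \<beta>,
            OF \<alpha>(2) \<beta>(2) flat_kernel_continuous_on[OF K0 True] subsetD[OF flat_space_subset_C_space that] True] that
        by (simp add: W0_def)
    qed (use that in \<open>auto simp: V_def W0_def\<close>)
  qed
  have V_restrict: "restrict (V T ?G) (flat_space T) = W0 T \<alpha> N p \<beta> K0"
    by (rule ext) (simp add: V_eq restrict_def W0_def)
  have factor: "L0 T \<alpha> N p \<beta> K0 f = (\<lambda>t\<in>{0..T}. D T \<alpha> f t + W0 T \<alpha> N p \<beta> K0 (D T \<alpha> f) t)"
    if f: "f \<in> flat_space T" for f
    using f D_flat[OF f] J_D_eq_D[OF T \<alpha>(2) \<beta>(2) f] J_D[OF T \<alpha>(2) f]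
    by (auto simp: L0_def W0_def add.assoc intro!: restrict_ext)
  have "L0_tilde T \<alpha> N p \<beta> K0 f = L0 T \<alpha> N p \<beta> K0 f" if f: "f \<in> flat_space T" for f
  proof -
    have "f \<in> J T \<alpha> ` C_space T"
      using f flat_eq image_mono by blast
    then show ?thesis
      using f D_flat[OF f] by (simp add: factor L0_tilde_def A_op_eq_D[OF T \<alpha>(2)] V_eq)
  qed
  then have "restrict (L0_tilde T \<alpha> N p \<beta> K0) (flat_space T) = L0 T \<alpha> N p \<beta> K0"
    by (auto simp: fun_eq_iff L0_def restrict_def)
  moreover have "restrict (A_op T \<alpha>) (flat_space T) = restrict (D T \<alpha>) (flat_space T)"
    by (intro restrict_ext A_op_eq_D[OF T \<alpha>(2)])
  moreover have "J T \<alpha> ` C_space T \<subseteq> C_space T"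
    using J_in_C_space[OF \<alpha>(2)] by blast
  ultimately show ?thesis
    using inj_on_J[OF T \<alpha>(2)] flat_eq image_mono flat_space_subset_C_space V_restrict factor D_flat
      bounded_Volterra_G0[OF T \<alpha>(2) \<beta>(2) K0] by (intro conjI ballI) auto
qed

end
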